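(* Let $G$ be a flag with $n\ge 10$ vertices. Then $G$ contains a proper set of $\lceil n/25\rceil+1$ pairwise disjoint edges.
   Context: Let $\mathcal C=S^1\times\mathbb R$ ($S^1=[0,1]$ with $0\sim 1$), points $p=(p_x,p_y)$ with $0\le p_x<1$; "left/right" refers to comparing $x$-coordinates in $[0,1)$. A cylindrical graph is a graph drawn on $\mathcal C$ with vertices as distinct points and edges as Jordan arcs, no overlapping edges, no edge through a vertex; simple if any two edges meet in at most one point (common endpoint or proper crossing); complete if all pairs of vertices are joined. A curve is $x$-monotone if each vertical line $l_{x=a}$ meets it at most once; the graph is monotone if all edges are $x$-monotone, no two vertices share an $x$-coordinate, and no vertex has $x$-coordinate $0$. A flag is a complete monotone simple cylindrical graph in which $l_{x=0}$ meets every edge in its relative interior. Two edges are disjoint if they share no point. Two $x$-monotone curves $e,f$ are related if they do not cross, some vertical line meets the relative interiors of both, and every vertical line meeting both relative interiors meets them in the same vertical order; then $e\prec f$ ("$e$ below $f$") means that for every vertical line $l$ meeting both relative interiors, the $y$-coordinate of $l\cap e$ is at most that of $l\cap f$. A point $v$ and an $x$-monotone curve $e$ are related if $l_{x=v_x}$ meets $e$ in its relative interior, and then $v$ is below $e$ if $v_y<(l_{x=v_x}\cap e)_y$ (above defined analogously). For edges $e=vu$, $f=wz$ without common vertices, $f$ has endpoints to the left of $e$ if $w_x,z_x<v_x,u_x$. A set $\mathcal E$ of pairwise disjoint edges of a flag $G$ is proper if any two $e,f\in\mathcal E$ are related, and whenever $e\prec f$ at least one of the following holds: (a) both endpoints of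 $e$ are to the left of both endpoints of $f$; (b) both endpoints of $f$ are to the left of both endpoints of $e$; (c) there is an edge $g$ of $G$ with both endpoints to the left of the endpoints of $e$ and of $f$ such that the endpoints of $e$ are below $g$ and the endpoints of $f$ are above $g$. *)

theory Defs
  imports "HOL-Analysis.Analysis"
begin

text \<open>The cylinder S^1 x R, embedded as pairs (z, y) with z on the complex unit circle.
  The point (cis (2 pi x), y) corresponds to the point (x, y) with x in [0,1).\<close>

type_synonym cpt = "complex \<times> real"

definition cyl :: "cpt set" where
  "cyl = {p. norm (fst p) = 1}"

definition px :: "cpt \<Rightarrow> real" where
  "px p = (if 0 \<le> Arg (fst p) then Arg (fst p) / (2 * pi) else Arg (fst p) / (2 * pi) + 1)"

definition py :: "cpt \<Rightarrow> real" where
  "py p = snd p"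

definition jordan_arc_cyl :: "cpt set \<Rightarrow> cpt \<Rightarrow> cpt \<Rightarrow> bool" where
  "jordan_arc_cyl C u v \<longleftrightarrow>
     (\<exists>g. arc g \<and> path_image g = C \<and> pathstart g = u \<and> pathfinish g = v \<and> C \<subseteq> cyl)"

definition x_monotone :: "cpt set \<Rightarrow> bool" where
  "x_monotone C \<longleftrightarrow> (\<forall>p\<in>C. \<forall>q\<in>C. px p = px q \<longrightarrow> p = q)"

text \<open>Strict vertical order of curves e (below) and f on the vertical lines with x-coordinate
  frac (px p + s * t), 0 < t < eps (s = 1: right of p, s = -1: left of p).\<close>
definition below_side :: "cpt set \<Rightarrow> cpt set \<Rightarrow> cpt \<Rightarrow> real \<Rightarrow> real \<Rightarrow> bool" where
  "below_side e f p eps s \<longleftrightarrow>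
     (\<forall>t\<in>{0<..<eps}. \<forall>q\<in>e. \<forall>r\<in>f.
        px q = frac (px p + s * t) \<and> px r = frac (px p + s * t) \<longrightarrow> py q < py r)"

text \<open>Proper crossing of two x-monotone curves e and f (with relative interiors ie and if')
  at the point p: p is an interior point of both, and the vertical order of the curves
  switches at p.\<close>
definition crosses_at :: "cpt set \<Rightarrow> cpt set \<Rightarrow> cpt set \<Rightarrow> cpt set \<Rightarrow> cpt \<Rightarrow> bool" where
  "crosses_at e ie f if' p \<longleftrightarrow> p \<in> ie \<and> p \<in> if' \<and>
     (\<exists>eps>0. (\<forall>t\<in>{0<..<eps}. \<forall>s\<in>{-1, 1::real}.
                  (\<exists>q\<in>e. px q = frac (px p + s * t)) \<and> (\<exists>r\<in>f. px r = frac (px p + s * t))) \<and>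
        ((below_side e f p eps (-1) \<and> below_side f e p eps 1) \<or>
         (below_side f e p eps (-1) \<and> below_side e f p eps 1)))"

text \<open>A complete graph on vertex set V is given by the curve E {u, v} of each edge {u, v}.\<close>
definition edges_of :: "cpt set \<Rightarrow> cpt set set" where
  "edges_of V = {{u, v} | u v. u \<in> V \<and> v \<in> V \<and> u \<noteq> v}"

definition rint :: "(cpt set \<Rightarrow> cpt set) \<Rightarrow> cpt set \<Rightarrow> cpt set" where
  "rint E e = E e - e"

definition complete_cyl_graph :: "cpt set \<Rightarrow> (cpt set \<Rightarrow> cpt set) \<Rightarrow> bool" where
  "complete_cyl_graph V E \<longleftrightarrow> finite V \<and> V \<subseteq> cyl \<and>
     (\<forall>u\<in>V. \<forall>v\<in>V. u \<noteq> v \<longrightarrow> jordan_arc_cyl (E {u, v}) u v) \<and>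
     (\<forall>e\<in>edges_of V. \<forall>w\<in>V. w \<notin> e \<longrightarrow> w \<notin> E e)"

definition monotone_graph :: "cpt set \<Rightarrow> (cpt set \<Rightarrow> cpt set) \<Rightarrow> bool" where
  "monotone_graph V E \<longleftrightarrow>
     (\<forall>e\<in>edges_of V. x_monotone (E e)) \<and>
     (\<forall>u\<in>V. \<forall>v\<in>V. px u = px v \<longrightarrow> u = v) \<and>
     (\<forall>v\<in>V. px v \<noteq> 0)"

definition simple_graph :: "cpt set \<Rightarrow> (cpt set \<Rightarrow> cpt set) \<Rightarrow> bool" where
  "simple_graph V E \<longleftrightarrow>
     (\<forall>e\<in>edges_of V. \<forall>f\<in>edges_of V. e \<noteq> f \<longrightarrow>
        (\<forall>p\<in>E e \<inter> E f. \<forall>q\<in>E e \<inter> E f. p = q) \<and>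
        (\<forall>p\<in>E e \<inter> E f. p \<in> e \<inter> f \<or> crosses_at (E e) (rint E e) (E f) (rint E f) p))"

definition flag :: "cpt set \<Rightarrow> (cpt set \<Rightarrow> cpt set) \<Rightarrow> bool" where
  "flag V E \<longleftrightarrow> complete_cyl_graph V E \<and> monotone_graph V E \<and> simple_graph V E \<and>
     (\<forall>e\<in>edges_of V. \<exists>p\<in>rint E e. px p = 0)"

definition related :: "(cpt set \<Rightarrow> cpt set) \<Rightarrow> cpt set \<Rightarrow> cpt set \<Rightarrow> bool" where
  "related E e f \<longleftrightarrow>
     \<not> (\<exists>p. crosses_at (E e) (rint E e) (E f) (rint E f) p) \<and>
     (\<exists>q\<in>rint E e. \<exists>r\<in>rint E f. px q = px r) \<and>
     ((\<forall>q\<in>rint E e. \<forall>r\<in>rint E f. px q = px r \<longrightarrow> py q \<le> py r) \<or>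
      (\<forall>q\<in>rint E e. \<forall>r\<in>rint E f. px q = px r \<longrightarrow> py r \<le> py q))"

definition edge_below :: "(cpt set \<Rightarrow> cpt set) \<Rightarrow> cpt set \<Rightarrow> cpt set \<Rightarrow> bool" where
  "edge_below E e f \<longleftrightarrow> related E e f \<and>
     (\<forall>q\<in>rint E e. \<forall>r\<in>rint E f. px q = px r \<longrightarrow> py q \<le> py r)"

definition pt_below :: "(cpt set \<Rightarrow> cpt set) \<Rightarrow> cpt \<Rightarrow> cpt set \<Rightarrow> bool" where
  "pt_below E v g \<longleftrightarrow> (\<exists>q\<in>rint E g. px q = px v \<and> py v < py q)"

definition pt_above :: "(cpt set \<Rightarrow> cpt set) \<Rightarrow> cpt \<Rightarrow> cpt set \<Rightarrow> bool" where
  "pt_above E v g \<longleftrightarrow> (\<exists>q\<in>rint E g. px q = px v \<and> py q < py v)"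

definition left_of :: "cpt set \<Rightarrow> cpt set \<Rightarrow> bool" where
  "left_of f e \<longleftrightarrow> (\<forall>w\<in>f. \<forall>v\<in>e. px w < px v)"

definition proper_set :: "cpt set \<Rightarrow> (cpt set \<Rightarrow> cpt set) \<Rightarrow> cpt set set \<Rightarrow> bool" where
  "proper_set V E M \<longleftrightarrow> M \<subseteq> edges_of V \<and>
     (\<forall>e\<in>M. \<forall>f\<in>M. e \<noteq> f \<longrightarrow> E e \<inter> E f = {}) \<and>
     (\<forall>e\<in>M. \<forall>f\<in>M. e \<noteq> f \<longrightarrow> related E e f) \<and>
     (\<forall>e\<in>M. \<forall>f\<in>M. e \<noteq> f \<longrightarrow> edge_below E e f \<longrightarrow>
        left_of e f \<or> left_of f e \<or>
        (\<exists>g\<in>edges_of V. left_of g e \<and> left_of g f \<and>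
           (\<forall>v\<in>e. pt_below E v g) \<and> (\<forall>w\<in>f. pt_above E w g)))"

end

theory Submission
  imports Defs
begin

text \<open>
  Number the vertices from left to right. Cut along the circle, the edge joining i < j is the
  graph of a continuous function over [x_j, 1 + x_i]. Write s(i,j,k) for "k lies above the edge
  ij" (i < j < k). Edges with a common vertex do not meet again, so s(i,j,k) fixes the order in
  which ij, ik, jk cross the line x = 0; hence along ijk, ijl, ikl, jkl the sign changes at most
  once. For i < j < k < l the edges ij and kl overlap in two ranges of x-coordinates, and as they
  meet at most once, s(i,j,l) = s(i,k,l). So s(i,j,k) = T(i,k) is independent of j, where
  T(i,l) is T(i,k) or T(j,l), and ij, kl are disjoint if and only if T(i,k) = T(j,l).

  It remains to find many pairs a1 < b1 < a2 < b2 < ... with T(a_i,a_j) = T(b_i,b_j): such edges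
  are even pairwise separated by a vertical line. An interval of n >= 2 vertices contains at
  least (n + 15) / 20 of them, by induction. If one of its first three rows changes sign away
  from the borders, then before and after the change the induction hypothesis applies
  separately, pairs on different sides are compatible since all earlier rows follow that row
  after the change, and the additive constant is gained twice. Otherwise two of these three rows
  are constant with the same sign away from the borders, so the corresponding two vertices form
  a pair that is compatible with every later one.
\<close>

section \<open>Chains of compatible pairs\<close>

text \<open>For \<open>T\<close> as in the overview this is the criterion for the two edges to be
  disjoint, with \<open>e\<close> entirely to the left of \<open>f\<close>.\<close>

definition disj_pairs :: "(nat \<Rightarrow> nat \<Rightarrow> bool) \<Rightarrow> nat \<times> nat \<Rightarrow> nat \<times> nat \<Rightarrow> bool" where
  "disj_pairs T e f \<longleftrightarrow> snd e < fst f \<and> T (fst e) (fst f) = T (snd e) (snd f)"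

definition pair_chain :: "(nat \<Rightarrow> nat \<Rightarrow> bool) \<Rightarrow> nat \<Rightarrow> nat \<Rightarrow> (nat \<times> nat) set \<Rightarrow> bool" where
  "pair_chain T l h M \<longleftrightarrow> finite M \<and> (\<forall>(a, b)\<in>M. l \<le> a \<and> a < b \<and> b < h) \<and>
     (\<forall>e\<in>M. \<forall>f\<in>M. e \<noteq> f \<longrightarrow> disj_pairs T e f \<or> disj_pairs T f e)"

text \<open>Lets a chain \<open>M\<close> be placed behind earlier pairs \<open>(a, b)\<close>: if
  the rows of \<open>a\<close> and \<open>b\<close> agree with \<open>r\<close> at the indices of
  \<open>M\<close>, then \<open>T a c = r c = r d = T b d\<close> for \<open>(c, d)\<close> in
  \<open>M\<close>.\<close>

definition row_mono :: "(nat \<Rightarrow> bool) \<Rightarrow> (nat \<times> nat) set \<Rightarrow> bool" where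
  "row_mono r M \<longleftrightarrow> (\<forall>(a, b)\<in>M. r a = r b)"

lemma pair_chain_bounds: "pair_chain T l h M \<Longrightarrow> (a, b) \<in> M \<Longrightarrow> l \<le> a \<and> a < b \<and> b < h"
  by (auto simp: pair_chain_def)

lemma row_monoD: "row_mono r M \<Longrightarrow> (a, b) \<in> M \<Longrightarrow> r a = r b"
  by (auto simp: row_mono_def)

lemma pair_chain_mono: "pair_chain T l h M \<Longrightarrow> l' \<le> l \<Longrightarrow> h \<le> h' \<Longrightarrow> pair_chain T l' h' M"
  unfolding pair_chain_def by fastforce

lemma pair_chain_single: "l \<le> a \<Longrightarrow> a < b \<Longrightarrow> b < h \<Longrightarrow> pair_chain T l h {(a, b)}"
  by (auto simp: pair_chain_def)

text \<open>Indices from \<open>h\<close> up to \<open>h'\<close> may be skipped, so that an index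
  between two blocks can stay free as a witness.\<close>

lemma pair_chain_join:
  assumes M: "pair_chain T l h M" and N: "pair_chain T h' k N"
    and "h \<le> h'" "l \<le> h'" "h \<le> k"
    and cr: "\<And>a b c d. (a, b) \<in> M \<Longrightarrow> (c, d) \<in> N \<Longrightarrow> T a c = T b d"
  shows "pair_chain T l k (M \<union> N)" and "card (M \<union> N) = card M + card N"
proof -
  have dj: "disj_pairs T e f" if "e \<in> M" "f \<in> N" for e f
    using that pair_chain_bounds[OF M, of "fst e" "snd e"] pair_chain_bounds[OF N, of "fst f" "snd f"]
      cr[of "fst e" "snd e" "fst f" "snd f"] \<open>h \<le> h'\<close>
    by (auto simp: disj_pairs_def)
  have "M \<inter> N = {}"
    using pair_chain_bounds[OF M] pair_chain_bounds[OF N] \<open>h \<le> h'\<close> by fastforce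
  then show "card (M \<union> N) = card M + card N"
    using M N by (auto simp: pair_chain_def card_Un_disjoint)
  show "pair_chain T l k (M \<union> N)"
    unfolding pair_chain_def
  proof (intro conjI ballI impI)
    show "finite (M \<union> N)" using M N by (auto simp: pair_chain_def)
  next
    fix e assume "e \<in> M \<union> N"
    then show "case e of (a, b) \<Rightarrow> l \<le> a \<and> a < b \<and> b < k"
      using pair_chain_bounds[OF M] pair_chain_bounds[OF N] assms(3-5) by fastforce
  next
    fix e f assume "e \<in> M \<union> N" "f \<in> M \<union> N" "e \<noteq> f"
    then show "disj_pairs T e f \<or> disj_pairs T f e"
      using dj M N unfolding pair_chain_def by blast
  qed
qed

lemma pair_chain_subset: "pair_chain T l h M \<Longrightarrow> N \<subseteq> M \<Longrightarrow> pair_chain T l h N"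
  unfolding pair_chain_def by (meson finite_subset subsetD)

section \<open>Lower bound for the size of chains\<close>

locale row_rule =
  fixes T :: "nat \<Rightarrow> nat \<Rightarrow> bool" and N :: nat
  assumes rule: "\<And>i j k l. i < j \<Longrightarrow> j < k \<Longrightarrow> k < l \<Longrightarrow> l < N \<Longrightarrow> T i l = T i k \<or> T i l = T j l"
begin

text \<open>Quantifying over all intervals of length \<open>n\<close> makes strong induction on
  \<open>n\<close> possible. With these constants one pair serves for \<open>n\<close> up to 5 and
  two pairs for \<open>n\<close> up to 25.\<close>

definition large :: "nat \<Rightarrow> bool" where
  "large n \<longleftrightarrow> (\<forall>l h. h \<le> N \<longrightarrow> h = l + n \<longrightarrow> 2 \<le> n \<longrightarrow> (\<exists>M. pair_chain T l h M \<and> n + 15 \<le> 20 * card M))"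

lemma largeD:
  "large n \<Longrightarrow> h \<le> N \<Longrightarrow> h = l + n \<Longrightarrow> 2 \<le> n \<Longrightarrow> \<exists>M. pair_chain T l h M \<and> n + 15 \<le> 20 * card M"
  unfolding large_def by blast

lemma row_mono_pair: "\<exists>a b. (l::nat) \<le> a \<and> a < b \<and> b < l + 3 \<and> r a = (r b :: bool)"
proof -
  consider "r l = r (l + 1)" | "r l = r (l + 2)" | "r (l + 1) = r (l + 2)" by blast
  then show ?thesis
  proof cases
    case 1 show ?thesis by (rule exI[of _ l], rule exI[of _ "l + 1"]) (use 1 in auto)
  next
    case 2 show ?thesis by (rule exI[of _ l], rule exI[of _ "l + 2"]) (use 2 in auto)
  next
    case 3 show ?thesis by (rule exI[of _ "l + 1"], rule exI[of _ "l + 2"]) (use 3 in auto)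
  qed
qed

text \<open>If row \<open>i\<close> does not change in the middle, trimming three indices at each
  border makes it constant, and \<open>15 - 6 = 9\<close> remains of the additive constant. A change
  in the middle splits the interval: a chain or a single pair before it joins a chain after it,
  because all rows starting before the change follow row \<open>i\<close> afterwards.\<close>

lemma row_mono_chain:
  assumes sm: "\<And>k. k < m0 \<Longrightarrow> large k"
    and "i < l" "h = l + m" "h \<le> N" "m \<le> m0"
  shows "(3 \<le> m \<longrightarrow> (\<exists>M. pair_chain T l h M \<and> row_mono (T i) M \<and> m + 9 \<le> 20 * card M)) \<and>
    ((\<exists>c\<in>{l+3..<h-3}. T i c \<noteq> T i (l+3)) \<longrightarrow>
       (\<exists>M. pair_chain T l h M \<and> row_mono (T i) M \<and> m + 18 \<le> 20 * card M))"
  using assms(2-)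
proof (induction m arbitrary: l rule: less_induct)
  case (less m)
  note il = \<open>i < l\<close> and h = \<open>h = l + m\<close>
  have IH: "\<exists>M. pair_chain T l' h M \<and> row_mono (T i) M \<and> h - l' + 9 \<le> 20 * card M"
    if "l < l'" "l' + 3 \<le> h" for l'
  proof -
    have "h - l' < m" "i < l'" "h = l' + (h - l')" "h - l' \<le> m0" "3 \<le> h - l'"
      using that less.prems by auto
    then show ?thesis using less.IH[of "h - l'" l'] \<open>h \<le> N\<close> by metis
  qed
  have changing: "\<exists>M. pair_chain T l h M \<and> row_mono (T i) M \<and> m + 18 \<le> 20 * card M"
    if nc: "\<exists>c\<in>{l+3..<h-3}. T i c \<noteq> T i (l+3)"
  proof -
    define P where "P c \<longleftrightarrow> l + 3 \<le> c \<and> T i c \<noteq> T i (l+3)" for c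
    \<comment> \<open>\<open>q\<close> is the first index at which row \<open>i\<close> leaves its
      value at \<open>l + 3\<close>; more than three indices remain from \<open>q\<close> on, enough
      for the induction hypothesis.\<close>
    define q where "q = (LEAST c. P c)"
    obtain c0 where c0: "P c0" "c0 < h - 3"
      using nc unfolding P_def by (meson atLeastLessThan_iff)
    have Pq: "P q" unfolding q_def using c0(1) by (rule LeastI)
    have "q \<le> c0" unfolding q_def using c0(1) by (rule Least_le)
    then have qh: "q < h - 3" using c0 by linarith
    have const: "T i c = T i (l+3)" if "l + 3 \<le> c" "c < q" for c
      using not_less_Least[of c P] that by (auto simp: q_def P_def)
    have q3: "l + 3 < q" using Pq by (cases "q = l + 3") (auto simp: P_def)
    then have "l < q" "l < q + 1" "q + 1 + 3 \<le> h" "q + 3 \<le> h" using qh by linarith+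
    show ?thesis
    proof (cases "q \<le> l + 5")
      case True
      obtain a b where ab: "l \<le> a" "a < b" "b < l + 3" "T i a = T i b"
        using row_mono_pair[of l "T i"] by blast
      obtain M where M: "pair_chain T (q+1) h M" "row_mono (T i) M" "(h - (q+1)) + 9 \<le> 20 * card M"
        using IH[OF \<open>l < q + 1\<close> \<open>q + 1 + 3 \<le> h\<close>] by blast
      \<comment> \<open>The rule is applied with \<open>l + 3\<close> and with \<open>q\<close> as
        third index. Row \<open>i\<close> differs at these two, so \<open>T i c\<close> cannot equal
        both values and must be \<open>T j c\<close>.\<close>
      have row: "T j c = T i c" if "l \<le> j" "j < l + 3" "q < c" "c < h" for j c
      proof -
        have "T i c = T i (l+3) \<or> T i c = T j c" "T i c = T i q \<or> T i c = T j c"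
          by (rule rule; use that q3 il \<open>h \<le> N\<close> in linarith)+
        then show ?thesis using Pq unfolding P_def by metis
      qed
      have cr: "T a' c = T b' d" if "(a', b') \<in> {(a, b)}" "(c, d) \<in> M" for a' b' c d
        using that row[of a c] row[of b d] ab row_monoD[OF M(2), of c d] pair_chain_bounds[OF M(1), of c d]
        by auto
      have S: "pair_chain T l (q+1) {(a, b)}" using ab q3 by (intro pair_chain_single) auto
      note J = pair_chain_join[OF S M(1) _ _ _ cr]
      show ?thesis
      proof (intro exI conjI)
        show "pair_chain T l h ({(a, b)} \<union> M)" using J(1) qh q3 by auto
        show "row_mono (T i) ({(a, b)} \<union> M)" using M(2) ab by (auto simp: row_mono_def)
        have "card ({(a, b)} \<union> M) = 1 + card M" using J(2) qh q3 by auto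
        \<comment> \<open>At most six indices are lost in front of \<open>q + 1\<close>, while the
          extra pair pays for 20.\<close>
        then show "m + 18 \<le> 20 * card ({(a, b)} \<union> M)" using M(3) h qh True by auto
      qed
    next
      case False
      \<comment> \<open>The first block ends before \<open>q - 1\<close>, which keeps this index
        strictly between \<open>j\<close> and \<open>c\<close>: now \<open>q - 1\<close> and
        \<open>q\<close> are the two places where row \<open>i\<close> differs.\<close>
      have "large (q - 1 - (l + 3))" using sm \<open>m \<le> m0\<close> h qh False by simp
      moreover have "q - 1 \<le> N" "q - 1 = l + 3 + (q - 1 - (l + 3))" "2 \<le> q - 1 - (l + 3)"
        using False qh \<open>h \<le> N\<close> by linarith+
      ultimately obtain K where
        K: "pair_chain T (l+3) (q-1) K" "q - 1 - (l + 3) + 15 \<le> 20 * card K"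
        by (blast dest: largeD)
      obtain M where M: "pair_chain T q h M" "row_mono (T i) M" "(h - q) + 9 \<le> 20 * card M"
        using IH[OF \<open>l < q\<close> \<open>q + 3 \<le> h\<close>] by blast
      have row: "T j c = T i c" if "l \<le> j" "j < q - 1" "q \<le> c" "c < h" for j c
      proof -
        have "T i (q - 1) = T i (l+3)" by (rule const) (use q3 in linarith)+
        then have ne: "T i (q - 1) \<noteq> T i q" using Pq unfolding P_def by metis
        have 1: "T i c = T i (q-1) \<or> T i c = T j c"
          by (rule rule; use that q3 il \<open>h \<le> N\<close> in linarith)
        have 2: "T i c = T i q \<or> T i c = T j c"
        proof (cases "c = q")
          case False
          show ?thesis by (rule rule; use that q3 il \<open>h \<le> N\<close> False in linarith)
        qed auto
        show ?thesis using 1 2 ne by metis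
      qed
      have cr: "T a c = T b d" if "(a, b) \<in> K" "(c, d) \<in> M" for a b c d
        using row[of a c] row[of b d] row_monoD[OF M(2) that(2)] pair_chain_bounds[OF M(1) that(2)]
          pair_chain_bounds[OF K(1) that(1)] by auto
      note J = pair_chain_join[OF K(1) M(1) _ _ _ cr]
      show ?thesis
      proof (intro exI conjI)
        have "pair_chain T (l+3) h (K \<union> M)" using J(1) qh q3 by auto
        then show "pair_chain T l h (K \<union> M)" by (rule pair_chain_mono) auto
        show "row_mono (T i) (K \<union> M)"
          unfolding row_mono_def
        proof clarify
          fix a b assume "(a, b) \<in> K \<union> M"
          then show "T i a = T i b"
            using row_monoD[OF M(2)] pair_chain_bounds[OF K(1), of a b] const[of a] const[of b] by auto
        qed
        have "card (K \<union> M) = card K + card M" using J(2) qh q3 by auto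
        \<comment> \<open>The block lengths \<open>q - l - 4\<close> and \<open>h - q\<close>
          together with the constants 15 and 9 add up to \<open>m + 20\<close>.\<close>
        then show "m + 18 \<le> 20 * card (K \<union> M)" using M(3) K(2) h qh False by auto
      qed
    qed
  qed
  moreover have "\<exists>M. pair_chain T l h M \<and> row_mono (T i) M \<and> m + 9 \<le> 20 * card M"
    if m3: "3 \<le> m"
  proof (cases "m \<ge> 8")
    case False
    obtain a b where ab: "l \<le> a" "a < b" "b < l + 3" "T i a = T i b"
      using row_mono_pair[of l "T i"] by blast
    show ?thesis
      by (rule exI[of _ "{(a, b)}"])
        (use ab m3 h False in \<open>auto simp: row_mono_def intro!: pair_chain_single\<close>)
  next
    case True
    show ?thesis
    proof (cases "\<exists>c\<in>{l+3..<h-3}. T i c \<noteq> T i (l+3)")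
      case True
      then obtain M where "pair_chain T l h M" "row_mono (T i) M" "m + 18 \<le> 20 * card M"
        using changing by blast
      then show ?thesis by (intro exI[of _ M]) auto
    next
      case False
      have "large (m - 6)" using sm \<open>m \<le> m0\<close> m3 by simp
      moreover have "h - 3 \<le> N" "h - 3 = l + 3 + (m - 6)" "2 \<le> m - 6"
        using True h \<open>h \<le> N\<close> by linarith+
      ultimately obtain K where
        K: "pair_chain T (l+3) (h-3) K" "m - 6 + 15 \<le> 20 * card K"
        by (blast dest: largeD)
      have "row_mono (T i) K"
        unfolding row_mono_def
      proof clarify
        fix a b assume "(a, b) \<in> K"
        then have "a \<in> {l+3..<h-3}" "b \<in> {l+3..<h-3}" using pair_chain_bounds[OF K(1)] by force+
        then show "T i a = T i b" using False by metis
      qed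
      moreover have "pair_chain T l h K" using K(1) by (rule pair_chain_mono) auto
      ultimately show ?thesis using K(2) True by (intro exI[of _ K]) auto
    qed
  qed
  ultimately show ?case by blast
qed

text \<open>Pigeonhole: among the truth values at \<open>(l, l+3)\<close>, \<open>(l+1, l+4)\<close>
  and \<open>(l+2, l+5)\<close> two agree, and their first and second indices form the two
  pairs.\<close>

lemma two_disjoint_pairs:
  assumes "l + 6 \<le> h"
  shows "\<exists>M. pair_chain T l h M \<and> card M = 2"
proof -
  have *: "\<exists>M. pair_chain T l h M \<and> card M = 2"
    if "l \<le> a" "a < b" "b < c" "c < d" "d < h" "T a c = T b d" for a b c d
  proof -
    have "pair_chain T l c {(a, b)}" "pair_chain T c h {(c, d)}"
      using that by (auto intro!: pair_chain_single)
    from pair_chain_join[OF this] that show ?thesis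
      by (intro exI[of _ "{(a, b)} \<union> {(c, d)}"]) auto
  qed
  consider "T l (l+3) = T (l+1) (l+4)" | "T l (l+3) = T (l+2) (l+5)"
    | "T (l+1) (l+4) = T (l+2) (l+5)" by blast
  then show ?thesis
  proof cases
    case 1 show ?thesis by (rule *[OF _ _ _ _ _ 1]) (use assms in auto)
  next
    case 2 show ?thesis by (rule *[OF _ _ _ _ _ 2]) (use assms in auto)
  next
    case 3 show ?thesis by (rule *[OF _ _ _ _ _ 3]) (use assms in auto)
  qed
qed

lemma all_large: "large n"
proof (induction n rule: less_induct)
  case (less n)
  show ?case
    unfolding large_def
  proof (intro allI impI)
    fix l h assume h: "h \<le> N" "h = l + n" and n2: "2 \<le> n"
    consider "n < 6" | "6 \<le> n" "n \<le> 25" | "25 < n" by linarith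
    then show "\<exists>M. pair_chain T l h M \<and> n + 15 \<le> 20 * card M"
    proof cases
      case 1
      show ?thesis
        by (rule exI[of _ "{(l, l+1)}"]) (use 1 h n2 in \<open>auto intro!: pair_chain_single\<close>)
    next
      case 2
      then obtain M where "pair_chain T l h M" "card M = 2"
        using two_disjoint_pairs[of l h] h by auto
      then show ?thesis using 2 by (intro exI[of _ M]) auto
    next
      case 3
      show ?thesis
      proof (cases "\<exists>i\<in>{l..<l+3}. \<exists>c\<in>{i+4..<h-3}. T i c \<noteq> T i (i+4)")
        case True
        then obtain i where "i \<in> {l..<l+3}" "\<exists>c\<in>{i+4..<h-3}. T i c \<noteq> T i (i+4)" by blast
        moreover have "i + 4 = i + 1 + 3" by simp
        ultimately have i: "l \<le> i" "i < l + 3" "\<exists>c\<in>{i+1+3..<h-3}. T i c \<noteq> T i (i+1+3)"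
          by (simp_all only: atLeastLessThan_iff)
        \<comment> \<open>At most three indices are lost up to and including \<open>i\<close>, which
          turns the constant 18 of a changing row into 15.\<close>
        have "i < i + 1" "h = i + 1 + (h - (i + 1))" "h - (i + 1) \<le> n" using i h 3 by auto
        from row_mono_chain[OF less.IH this(1,2) h(1) this(3)] i(3)
        obtain M where M: "pair_chain T (i+1) h M" "h - (i + 1) + 18 \<le> 20 * card M" by blast
        show ?thesis
        proof (intro exI conjI)
          show "pair_chain T l h M" using M(1) by (rule pair_chain_mono) (use i in auto)
          show "n + 15 \<le> 20 * card M" using M(2) i h 3 by auto
        qed
      next
        case False
        have const: "T i c = T i (l+6)" if "l \<le> i" "i < l + 3" "l + 6 \<le> c" "c < h - 3" for i c
        proof -
          have "i \<in> {l..<l+3}" "c \<in> {i+4..<h-3}" "l + 6 \<in> {i+4..<h-3}" using that by auto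
          then have "T i c = T i (i+4)" "T i (l+6) = T i (i+4)" using False by metis+
          then show ?thesis by simp
        qed
        obtain a b where ab: "l \<le> a" "a < b" "b < l + 3" "T a (l+6) = T b (l+6)"
          using row_mono_pair[of l "\<lambda>i. T i (l+6)"] by blast
        \<comment> \<open>Trimming six indices on the left and three on the right costs 9, less than
          the 20 gained by the pair \<open>(a, b)\<close>.\<close>
        have "large (n - 9)" using less.IH 3 by simp
        moreover have "h - 3 \<le> N" "h - 3 = l + 6 + (n - 9)" "2 \<le> n - 9"
          using 3 h by linarith+
        ultimately obtain K where
          K: "pair_chain T (l+6) (h-3) K" "n - 9 + 15 \<le> 20 * card K"
          by (blast dest: largeD)
        have S: "pair_chain T l (l+6) {(a, b)}" using ab by (intro pair_chain_single) auto
        have cr: "T a' c = T b' d" if "(a', b') \<in> {(a, b)}" "(c, d) \<in> K" for a' b' c d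
          using that const[of a c] const[of b d] ab pair_chain_bounds[OF K(1) that(2)] by auto
        note J = pair_chain_join[OF S K(1) _ _ _ cr]
        have "pair_chain T l (h-3) ({(a, b)} \<union> K)" using J(1) h 3 by auto
        then have "pair_chain T l h ({(a, b)} \<union> K)" by (rule pair_chain_mono) auto
        moreover have "card ({(a, b)} \<union> K) = 1 + card K" using J(2) h 3 by auto
        ultimately show ?thesis using K(2) 3 by (intro exI[of _ "{(a, b)} \<union> K"]) auto
      qed
    qed
  qed
qed

lemma pair_chain_exists:
  assumes "2 \<le> N"
  shows "\<exists>M. pair_chain T 0 N M \<and> N + 15 \<le> 20 * card M"
  using largeD[OF all_large[of N], of N 0] assms by simp

end

section \<open>Edges as graphs of functions\<close>

lemma cis_2pi_eq_iff: "cis (2 * pi * x) = cis (2 * pi * y) \<longleftrightarrow> x - y \<in> \<int>"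
proof
  assume "cis (2 * pi * x) = cis (2 * pi * y)"
  then have "sin (2 * pi * x) = sin (2 * pi * y)" "cos (2 * pi * x) = cos (2 * pi * y)"
    by (auto simp: complex_eq_iff)
  then obtain k where "2 * pi * x = 2 * pi * y + 2 * pi * of_int k"
    using sin_cos_eq_iff by metis
  then have "2 * pi * (x - y) = 2 * pi * of_int k" by (simp add: algebra_simps)
  then have "x - y = of_int k" using pi_gt_zero mult_cancel_left by (metis mult_eq_0_iff pi_neq_zero zero_neq_numeral)
  then show "x - y \<in> \<int>" by simp
next
  assume "x - y \<in> \<int>"
  then have "cis (2 * pi * (x - y)) = 1" by simp
  moreover have "cis (2 * pi * x) = cis (2 * pi * (x - y)) * cis (2 * pi * y)"
    by (simp add: cis_mult algebra_simps)
  ultimately show "cis (2 * pi * x) = cis (2 * pi * y)" by simp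
qed

lemma cyl_px:
  assumes "p \<in> cyl"
  shows "0 \<le> px p" "px p < 1" "fst p = cis (2 * pi * px p)"
proof -
  have n: "norm (fst p) = 1" using assms by (simp add: cyl_def)
  then have "fst p \<noteq> 0" by auto
  then have c: "cis (Arg (fst p)) = fst p" using n by (simp add: cis_Arg sgn_div_norm)
  have bd: "- pi < Arg (fst p)" "Arg (fst p) \<le> pi" using Arg_bounded by auto
  show "0 \<le> px p" using bd by (auto simp: px_def field_simps)
  show "px p < 1" using bd by (auto simp: px_def field_simps)
  have "2 * pi * px p = (if 0 \<le> Arg (fst p) then Arg (fst p) else Arg (fst p) + 2 * pi)"
    by (simp add: px_def distrib_left)
  then have "cis (2 * pi * px p) = cis (Arg (fst p))" by (simp flip: cis_mult)
  then show "fst p = cis (2 * pi * px p)" using c by simp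
qed

lemma px_cis: "px (cis (2 * pi * t), y) = frac t"
proof -
  define p where "p = (cis (2 * pi * t), y)"
  have "p \<in> cyl" by (simp add: p_def cyl_def)
  from cyl_px[OF this] have "0 \<le> px p" "px p < 1" "cis (2 * pi * t) = cis (2 * pi * px p)"
    by (auto simp: p_def)
  then have "frac t = px p" by (auto simp: frac_unique_iff cis_2pi_eq_iff)
  then show ?thesis by (simp add: p_def)
qed

lemma frac_eq_near:
  fixes s t :: real
  assumes "frac s = frac t" "\<bar>s - t\<bar> < 1"
  shows "s = t"
proof -
  have "s - t = of_int (\<lfloor>s\<rfloor> - \<lfloor>t\<rfloor>)" using assms(1) by (simp add: frac_def)
  moreover from this have "\<lfloor>s\<rfloor> - \<lfloor>t\<rfloor> = 0" using assms(2) by linarith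
  ultimately show ?thesis by simp
qed

text \<open>Lifted parameters of edges lie between 0 and 2, so two lifts of the same x-coordinate
  differ by at most one turn.\<close>

lemma frac_eq_cases:
  fixes s t :: real
  assumes "frac s = frac t" "\<bar>s - t\<bar> < 2"
  shows "s = t \<or> s = t + 1 \<or> t = s + 1"
proof -
  have e: "s - t = of_int (\<lfloor>s\<rfloor> - \<lfloor>t\<rfloor>)" using assms(1) by (simp add: frac_def)
  then have "\<lfloor>s\<rfloor> - \<lfloor>t\<rfloor> \<in> {-1, 0, 1}" using assms(2) by (simp, linarith)
  then show ?thesis using e by fastforce
qed

text \<open>Intermediate value theorem for \<open>f - g\<close>.\<close>

lemma order_constant:
  fixes f g :: "real \<Rightarrow> real"
  assumes f: "continuous_on A f" and g: "continuous_on B g" and sub: "{u..v} \<subseteq> A" "{u..v} \<subseteq> B"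
    and ne: "\<And>x. x \<in> {u..v} \<Longrightarrow> f x \<noteq> g x" and "x \<in> {u..v}" "y \<in> {u..v}"
  shows "f x < g x \<longleftrightarrow> f y < g y"
proof -
  have *: "f y < g y" if xy: "x \<in> {u..v}" "y \<in> {u..v}" and lt: "f x < g x" for x y
  proof (rule ccontr)
    assume "\<not> f y < g y"
    then have gt: "g y \<le> f y" by simp
    have cont: "continuous_on {x..y} (\<lambda>t. f t - g t)" "continuous_on {y..x} (\<lambda>t. f t - g t)"
      by (intro continuous_on_diff continuous_on_subset[OF f] continuous_on_subset[OF g];
          use xy sub in force)+
    obtain t where "t \<in> {x..y} \<union> {y..x}" "f t = g t"
    proof (cases "x \<le> y")
      case True
      with IVT'[OF _ _ True cont(1), of 0] lt gt show ?thesis by (auto intro: that)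
    next
      case False
      then have "y \<le> x" by simp
      with IVT2'[OF _ _ this cont(2), of 0] lt gt show ?thesis by (auto intro: that)
    qed
    moreover have "t \<in> {u..v}" using xy calculation(1) by auto
    ultimately show False using ne by blast
  qed
  show ?thesis using *[of x y] *[of y x] assms(6,7) by blast
qed

text \<open>Lifting the arc to the universal cover, its first coordinate becomes injective even
  modulo 1, so its range is shorter than 1; meeting the line at 0 decides the direction.\<close>

lemma arc_is_graph:
  assumes arc: "arc g" and cyl: "path_image g \<subseteq> cyl" and mono: "x_monotone (path_image g)"
    and ab: "0 < px (pathstart g)" "px (pathstart g) < px (pathfinish g)"
    and z: "p \<in> path_image g" "px p = 0"
  shows "\<exists>\<phi>. continuous_on {px (pathfinish g)..1 + px (pathstart g)} \<phi> \<and>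
    path_image g = (\<lambda>t. (cis (2 * pi * t), \<phi> t)) ` {px (pathfinish g)..1 + px (pathstart g)}"
proof -
  define a b where "a = px (pathstart g)" and "b = px (pathfinish g)"
  have gc: "continuous_on {0..1} g" and inj: "inj_on g {0..1}"
    using arc by (auto simp: arc_def path_def)
  have gcyl: "g t \<in> cyl" if "t \<in> {0..1}" for t using that cyl by (auto simp: path_image_def)
  have "continuous_on {0..1} (\<lambda>t. fst (g t))" using gc by (intro continuous_intros)
  moreover have "contractible {0..1::real}" by (simp add: convex_imp_contractible)
  moreover have "fst (g t) \<noteq> 0" if "t \<in> {0..1}" for t using gcyl[OF that] by (auto simp: cyl_def)
  ultimately obtain h where h: "continuous_on {0..1} h" "\<And>t. t \<in> {0..1} \<Longrightarrow> fst (g t) = exp (h t)"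
    using continuous_logarithm_on_contractible by (metis (no_types, lifting))
  \<comment> \<open>The shift makes the lift \<open>th\<close> start at \<open>1 + a\<close>. That
    \<open>m\<close> is an integer, so that \<open>th\<close> still lifts the same arc, follows
    since the arc starts at x-coordinate \<open>a\<close>.\<close>
  define m where "m = Im (h 0) / (2 * pi) - a"
  define th where "th t = Im (h t) / (2 * pi) - m + 1" for t
  have thc: "continuous_on {0..1} th" unfolding th_def using h(1) by (intro continuous_intros) auto
  have im: "fst (g t) = cis (2 * pi * (th t + m - 1))" if "t \<in> {0..1}" for t
  proof -
    have "norm (exp (h t)) = 1" using gcyl[OF that] h(2)[OF that] by (simp add: cyl_def)
    then have "Re (h t) = 0" by simp
    then show ?thesis using h(2)[OF that] by (simp add: exp_eq_polar th_def)
  qed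
  have "px (g 0) = frac (th 0 + m - 1)"
    using px_cis[of "th 0 + m - 1" "snd (g 0)"] im[of 0] by (metis atLeastAtMost_iff order_refl prod.collapse zero_le_one)
  moreover have th0: "th 0 = 1 + a" by (simp add: th_def m_def)
  moreover have "px (g 0) = a" by (simp add: a_def pathstart_def)
  ultimately have "frac (a + m) = a" by simp
  then have mZ: "m \<in> \<int>" by (simp add: frac_unique_iff)
  have g_eq: "g t = (cis (2 * pi * th t), snd (g t))" if "t \<in> {0..1}" for t
  proof -
    have "cis (2 * pi * (th t + m - 1)) = cis (2 * pi * th t)" using mZ by (simp add: cis_2pi_eq_iff)
    then show ?thesis using im[OF that] by (simp add: prod_eq_iff)
  qed
  have pxg: "px (g t) = frac (th t)" if "t \<in> {0..1}" for t
    using arg_cong[OF g_eq[OF that], of px] px_cis by (rule trans)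
  have frac_inj: "s = t" if "s \<in> {0..1}" "t \<in> {0..1}" "frac (th s) = frac (th t)" for s t
  proof -
    have "px (g s) = px (g t)" using that by (simp add: pxg)
    moreover have "g s \<in> path_image g" "g t \<in> path_image g" using that by (auto simp: path_image_def)
    ultimately have "g s = g t" using mono unfolding x_monotone_def by blast
    then show ?thesis using inj that by (auto dest: inj_onD)
  qed
  have th_inj: "inj_on th {0..1}" by (rule inj_onI) (simp add: frac_inj)
  have bd: "a < 1" "b < 1" "0 < a" "a < b"
    using cyl_px(2)[of "g 0"] cyl_px(2)[of "g 1"] gcyl[of 0] gcyl[of 1] ab
    by (auto simp: a_def b_def pathstart_def pathfinish_def)
  have frac1: "frac (th 1) = b" using pxg[of 1] by (simp add: b_def pathfinish_def)
  \<comment> \<open>Otherwise the lift would attain \<open>th 0 + 1\<close>, a repetition modulo 1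
    that \<open>frac_inj\<close> forbids; the bound from below is symmetric.\<close>
  have "th 1 < th 0 + 1"
  proof (rule ccontr)
    assume "\<not> th 1 < th 0 + 1"
    then obtain t where t: "0 \<le> t" "t \<le> 1" "th t = th 0 + 1"
      using IVT'[of th 0 "th 0 + 1" 1] thc by auto
    then have "frac (th t) = frac (th 0)" by (simp add: frac_1_eq)
    then show False using frac_inj[of t 0] t by auto
  qed
  moreover have "th 1 > th 0 - 1"
  proof (rule ccontr)
    assume "\<not> th 1 > th 0 - 1"
    then obtain t where t: "0 \<le> t" "t \<le> 1" "th t = th 0 - 1"
      using IVT2'[of th 1 "th 0 - 1" 0] thc by auto
    then have "frac (th 0) = frac (th t + 1)" by simp
    then have "frac (th t) = frac (th 0)" by (simp add: frac_1_eq)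
    then show False using frac_inj[of t 0] t by auto
  qed
  moreover have "frac (th 1) = frac b" using frac1 bd by (simp add: frac_eq)
  ultimately have "th 1 = b \<or> th 1 = b + 1"
    using frac_eq_cases[of "th 1" b] th0 bd by auto
  \<comment> \<open>A lift rising from \<open>1 + a\<close> to \<open>1 + b\<close> stays strictly
    between 1 and 2, so the arc would miss the line at 0 through \<open>p\<close>.\<close>
  moreover have "th 1 \<noteq> b + 1"
  proof
    assume e: "th 1 = b + 1"
    obtain t where t: "t \<in> {0..1}" "p = g t" using z by (auto simp: path_image_def)
    have "th t \<in> {1 + a..1 + b}"
      using continuous_inj_imp_mono[of 0 t 1 th] thc th_inj t e th0 bd
      by (cases "t = 0 \<or> t = 1") auto
    then have "frac (th t) = th t - 1" using bd by (auto simp: frac_unique_iff)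
    moreover have "frac (th t) = 0" using pxg[OF t(1)] t z by simp
    ultimately show False using \<open>th t \<in> {1 + a..1 + b}\<close> bd by simp
  qed
  ultimately have th1: "th 1 = b" by simp
  have im: "th ` {0..1} = {b..1 + a}"
  proof
    show "th ` {0..1} \<subseteq> {b..1 + a}"
    proof
      fix x assume "x \<in> th ` {0..1}"
      then obtain t where t: "t \<in> {0..1}" "x = th t" by blast
      then show "x \<in> {b..1 + a}"
        using continuous_inj_imp_mono[of 0 t 1 th] thc th_inj th1 th0 bd
        by (cases "t = 0 \<or> t = 1") auto
    qed
    show "{b..1 + a} \<subseteq> th ` {0..1}"
    proof
      fix x assume "x \<in> {b..1 + a}"
      then show "x \<in> th ` {0..1}" using IVT2'[of th 1 x 0] thc th0 th1 by force
    qed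
  qed
  \<comment> \<open>The inverse of \<open>th\<close> reparametrizes the arc by its lifted
    x-coordinate.\<close>
  define ps where "ps = the_inv_into {0..1} th"
  have psth: "ps (th t) = t" if "t \<in> {0..1}" for t
    unfolding ps_def using th_inj that by (rule the_inv_into_f_f)
  have psc: "continuous_on {b..1 + a} ps"
    using continuous_on_inv[OF thc, of ps] psth im by auto
  have psim: "ps ` {b..1 + a} = {0..1}"
    using psth by (force simp flip: im)
  define \<phi> where "\<phi> = (\<lambda>x. snd (g (ps x)))"
  have "continuous_on {b..1 + a} (\<lambda>x. g (ps x))"
    using continuous_on_compose2[OF gc psc] psim by auto
  then have "continuous_on {b..1 + a} \<phi>" unfolding \<phi>_def by (rule continuous_on_snd)
  moreover have "path_image g = (\<lambda>t. (cis (2 * pi * t), \<phi> t)) ` {b..1 + a}"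
  proof -
    have "path_image g = (\<lambda>t. (cis (2 * pi * th t), \<phi> (th t))) ` {0..1}"
      unfolding path_image_def
      by (rule image_cong) (use g_eq psth in \<open>auto simp: \<phi>_def\<close>)
    also have "\<dots> = (\<lambda>t. (cis (2 * pi * t), \<phi> t)) ` th ` {0..1}"
      by (simp add: image_image)
    finally show ?thesis by (simp add: im)
  qed
  ultimately show ?thesis unfolding a_def b_def by blast
qed

section \<open>Height functions of the edges of a flag\<close>

locale cyl_flag =
  fixes V :: "cpt set" and E :: "cpt set \<Rightarrow> cpt set"
  assumes flag: "flag V E"
begin

text \<open>Determined by the point on the circle and hence 1-periodic in \<open>t\<close>: the edge
  is described over every translate of \<open>[px b, 1 + px a]\<close>.\<close>

definition ht :: "cpt \<Rightarrow> cpt \<Rightarrow> real \<Rightarrow> real" where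
  "ht a b t = (THE y. (cis (2 * pi * t), y) \<in> E {a, b})"

lemma px_vertex: "v \<in> V \<Longrightarrow> 0 < px v" "v \<in> V \<Longrightarrow> px v < 1"
  using flag cyl_px[of v]
  by (auto simp: flag_def monotone_graph_def complete_cyl_graph_def less_le)

lemma edge_in: "u \<in> V \<Longrightarrow> v \<in> V \<Longrightarrow> px u < px v \<Longrightarrow> {u, v} \<in> edges_of V"
  unfolding edges_of_def by (rule CollectI, rule exI[of _ u], rule exI[of _ v]) auto

lemma edge_arc:
  assumes "u \<in> V" "v \<in> V" "u \<noteq> v"
  obtains g where "arc g" "path_image g = E {u, v}" "pathstart g = u" "pathfinish g = v" "E {u, v} \<subseteq> cyl"
proof -
  have "jordan_arc_cyl (E {u, v}) u v"
    using flag assms unfolding flag_def complete_cyl_graph_def by blast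
  then show ?thesis using that unfolding jordan_arc_cyl_def by blast
qed

lemma vertex_in_edge:
  assumes "e \<in> edges_of V" "w \<in> e"
  shows "w \<in> E e"
proof -
  obtain u v where uv: "e = {u, v}" "u \<in> V" "v \<in> V" "u \<noteq> v"
    using assms by (auto simp: edges_of_def)
  obtain g where g: "path_image g = E {u, v}" "pathstart g = u" "pathfinish g = v"
    using uv(2-4) by (rule edge_arc)
  then have "u \<in> E {u, v}" "v \<in> E {u, v}"
    using pathstart_in_path_image[of g] pathfinish_in_path_image[of g] by auto
  then show ?thesis using assms(2) uv(1) by auto
qed

lemma ht_graph:
  assumes V: "a \<in> V" "b \<in> V" and lt: "px a < px b"
  shows "continuous_on {px b..1 + px a} (ht a b)"
    and "E {a, b} = (\<lambda>t. (cis (2 * pi * t), ht a b t)) ` {px b..1 + px a}"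
proof -
  obtain g where g: "arc g" "path_image g = E {a, b}" "pathstart g = a" "pathfinish g = b"
    "E {a, b} \<subseteq> cyl"
    using edge_arc[OF V] lt by blast
  have "x_monotone (E {a, b})"
    using flag edge_in[OF V lt] unfolding flag_def monotone_graph_def by blast
  moreover obtain p where "p \<in> E {a, b}" "px p = 0"
    using flag edge_in[OF V lt] unfolding flag_def rint_def by blast
  ultimately obtain \<phi> where c: "continuous_on {px b..1 + px a} \<phi>"
    and im: "E {a, b} = (\<lambda>t. (cis (2 * pi * t), \<phi> t)) ` {px b..1 + px a}"
    using arc_is_graph[OF g(1), of p] px_vertex(1)[OF V(1)] lt unfolding g(2-4) using g(5) by blast
  have eq: "ht a b t = \<phi> t" if t: "t \<in> {px b..1 + px a}" for t
    unfolding ht_def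
  proof (rule the_equality)
    show "(cis (2 * pi * t), \<phi> t) \<in> E {a, b}" unfolding im using t by blast
  next
    fix y assume "(cis (2 * pi * t), y) \<in> E {a, b}"
    then obtain s where s: "s \<in> {px b..1 + px a}" "cis (2 * pi * t) = cis (2 * pi * s)" "y = \<phi> s"
      unfolding im by blast
    have "frac t = frac s" using px_cis[of t 0] px_cis[of s 0] unfolding s(2) by (rule trans[OF sym])
    then have "t = s" by (rule frac_eq_near) (use s t lt in auto)
    then show "y = \<phi> t" using s by simp
  qed
  have "continuous_on {px b..1 + px a} (ht a b) \<longleftrightarrow> continuous_on {px b..1 + px a} \<phi>"
    by (rule continuous_on_cong[OF refl eq])
  then show "continuous_on {px b..1 + px a} (ht a b)" using c by (rule iffD2)
  show "E {a, b} = (\<lambda>t. (cis (2 * pi * t), ht a b t)) ` {px b..1 + px a}"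
    unfolding im by (rule image_cong[OF refl]) (simp only: eq)
qed

lemma ht_periodic: "ht a b (t + 1) = ht a b t"
proof -
  have "cis (2 * pi * (t + 1)) = cis (2 * pi * t)" by (simp add: cis_2pi_eq_iff)
  then show ?thesis by (simp add: ht_def)
qed

text \<open>Each endpoint lies on the edge over some parameter with the right fractional part, and
  the parameter interval is shorter than 1, so that parameter is unique. The edge leaves
  \<open>b\<close> to the right and reaches \<open>a\<close> after passing the line at 0.\<close>

lemma ht_ends:
  assumes V: "a \<in> V" "b \<in> V" and lt: "px a < px b"
  shows "ht a b (px b) = py b" "ht a b (1 + px a) = py a"
proof -
  note bd = px_vertex(1)[OF V(1)] px_vertex(2)[OF V(2)]
  have e: "{a, b} \<in> edges_of V" using edge_in[OF V lt] .
  have *: "\<exists>t\<in>{px b..1 + px a}. frac t = px w \<and> py w = ht a b t" if w: "w \<in> {a, b}" for w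
  proof -
    obtain t where "t \<in> {px b..1 + px a}" "w = (cis (2 * pi * t), ht a b t)"
      using vertex_in_edge[OF e w] ht_graph(2)[OF V lt] by auto
    then show ?thesis using px_cis[of t "ht a b t"] by (intro bexI[of _ t]) (auto simp: py_def)
  qed
  obtain t where t: "t \<in> {px b..1 + px a}" "frac t = px b" "py b = ht a b t" using *[of b] by auto
  have "t = px b" by (rule frac_eq_near) (use t bd lt in auto)
  then show "ht a b (px b) = py b" using t by simp
  obtain s where s: "s \<in> {px b..1 + px a}" "frac s = px a" "py a = ht a b s" using *[of a] by auto
  have "frac (1 + px a) = px a" using bd lt by (auto simp: frac_unique_iff)
  then have "frac s = frac (1 + px a)" by (simp only: s(2))
  then have "s = 1 + px a" by (rule frac_eq_near) (use s(1) bd lt in auto)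
  then show "ht a b (1 + px a) = py a" using s by simp
qed

section \<open>Edges with a common vertex and signs of triples\<close>

lemma common_vertex:
  assumes "e \<in> edges_of V" "f \<in> edges_of V" "e \<noteq> f" "w \<in> e" "w \<in> f" "p \<in> E e" "p \<in> E f"
  shows "p = w"
proof -
  have "w \<in> E e \<inter> E f" "p \<in> E e \<inter> E f" using assms vertex_in_edge by auto
  then show ?thesis using flag assms(1-3) unfolding flag_def simple_graph_def by blast
qed

lemma adjacent_edges_meet:
  assumes V: "a \<in> V" "b \<in> V" "c \<in> V" "d \<in> V" and lt: "px a < px b" "px c < px d"
    and w: "{a, b} \<noteq> {c, d}" "w \<in> {a, b}" "w \<in> {c, d}"
    and t: "t \<in> {px b..1 + px a}" "t \<in> {px d..1 + px c}" "ht a b t = ht c d t"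
  shows "t = px w \<or> t = 1 + px w"
proof -
  have "(cis (2 * pi * t), ht a b t) \<in> E {a, b}" "(cis (2 * pi * t), ht a b t) \<in> E {c, d}"
    using ht_graph(2)[OF V(1,2) lt(1)] ht_graph(2)[OF V(3,4) lt(2)] t by auto
  then have "(cis (2 * pi * t), ht a b t) = w"
    using common_vertex[OF edge_in[OF V(1,2) lt(1)] edge_in[OF V(3,4) lt(2)] w] by blast
  then have "px w = frac t" using px_cis[of t "ht a b t"] by simp
  then have "frac t = frac (px w)" by simp
  moreover have bd: "0 < t" "t < 2" using px_vertex(1)[OF V(2)] px_vertex(2)[OF V(1)] t by auto
  moreover have "w \<in> V" using V w by auto
  note bw = px_vertex[OF this]
  ultimately have "t = px w \<or> t = px w + 1 \<or> px w = t + 1"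
    using bw by (intro frac_eq_cases) auto
  then show ?thesis using bd bw by linarith
qed

text \<open>The sign s of the overview, intended for \<open>px a < px b < px c\<close>; then
  \<open>px c\<close> lies in the parameter interval of the edge \<open>{a, b}\<close>.\<close>

definition above :: "cpt \<Rightarrow> cpt \<Rightarrow> cpt \<Rightarrow> bool" where
  "above a b c \<longleftrightarrow> ht a b (px c) < py c"

text \<open>Any two of the three edges share a vertex and do not meet elsewhere, so their order can
  be carried from \<open>px c\<close> to 1 and on to \<open>1 + px a\<close>. At \<open>px c\<close>
  the edges into \<open>c\<close> have height \<open>py c\<close>; at \<open>1 + px a\<close> the
  edges into \<open>a\<close> have height \<open>py a\<close>.\<close>

lemma triple_order:
  assumes V: "a \<in> V" "b \<in> V" "c \<in> V" and lt: "px a < px b" "px b < px c"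
  shows "(above a b c \<and> ht a b 1 < ht a c 1 \<and> ht a c 1 < ht b c 1) \<or>
      (\<not> above a b c \<and> ht b c 1 < ht a c 1 \<and> ht a c 1 < ht a b 1)"
    and "above a b c \<longleftrightarrow> py a < ht b c (1 + px a)"
proof -
  have ac: "px a < px c" using lt by simp
  note bd = px_vertex(1)[OF V(1)] px_vertex(2)[OF V(3)]
  note cont = ht_graph(1)[OF V(1,2) lt(1)] ht_graph(1)[OF V(2,3) lt(2)] ht_graph(1)[OF V(1,3) ac]
  note ends = ht_ends[OF V(1,2) lt(1)] ht_ends[OF V(2,3) lt(2)] ht_ends[OF V(1,3) ac]
  have ne: "{a, b} \<noteq> {a, c}" "{a, b} \<noteq> {b, c}" "{a, c} \<noteq> {b, c}"
    using lt by (auto simp: doubleton_eq_iff)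
  have ab_ac: "ht a b t \<noteq> ht a c t" if "t \<in> {px c..1}" for t
    using adjacent_edges_meet[OF V(1,2) V(1,3) lt(1) ac ne(1), of a t] that bd lt by auto
  have ab_bc: "ht a b t \<noteq> ht b c t" if "t \<in> {px c..1 + px a}" for t
    using adjacent_edges_meet[OF V(1,2) V(2,3) lt ne(2), of b t] that bd lt by auto
  have ac_bc: "ht a c t \<noteq> ht b c t" if "t \<in> {1..1 + px a}" for t
    using adjacent_edges_meet[OF V(1,3) V(2,3) ac lt(2) ne(3), of c t] that bd lt by auto
  have 1: "ht a b x < ht a c x \<longleftrightarrow> ht a b y < ht a c y" if "x \<in> {px c..1}" "y \<in> {px c..1}" for x y
    by (rule order_constant[OF cont(1) cont(3) _ _ ab_ac that])
      (use bd lt in auto)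
  have 2: "ht a b x < ht b c x \<longleftrightarrow> ht a b y < ht b c y"
    if "x \<in> {px c..1 + px a}" "y \<in> {px c..1 + px a}" for x y
    by (rule order_constant[OF cont(1) cont(2) _ _ ab_bc that])
      (use bd lt in auto)
  have 3: "ht a c x < ht b c x \<longleftrightarrow> ht a c y < ht b c y"
    if "x \<in> {1..1 + px a}" "y \<in> {1..1 + px a}" for x y
    by (rule order_constant[OF cont(3) cont(2) _ _ ac_bc that])
      (use bd lt in auto)
  have "above a b c \<longleftrightarrow> ht a b 1 < ht a c 1"
    using 1[of "px c" 1] ends bd by (auto simp: above_def)
  moreover have "above a b c \<longleftrightarrow> ht a b 1 < ht b c 1"
    using 2[of "px c" 1] ends bd by (auto simp: above_def)
  moreover show "above a b c \<longleftrightarrow> py a < ht b c (1 + px a)"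
    using 2[of "px c" "1 + px a"] ends bd by (auto simp: above_def)
  moreover have "ht a c 1 < ht b c 1 \<longleftrightarrow> py a < ht b c (1 + px a)"
    using 3[of 1 "1 + px a"] ends bd by auto
  moreover have "ht a b 1 \<noteq> ht a c 1" "ht a c 1 \<noteq> ht b c 1"
    using ab_ac[of 1] ac_bc[of 1] bd by auto
  ultimately show "(above a b c \<and> ht a b 1 < ht a c 1 \<and> ht a c 1 < ht b c 1) \<or>
      (\<not> above a b c \<and> ht b c 1 < ht a c 1 \<and> ht a c 1 < ht a b 1)"
    by argo
qed

text \<open>The order of the six edges on the line at 0 allows at most one sign change along the
  triples abc, abd, acd, bcd.\<close>

lemma quadruple_order:
  assumes V: "a \<in> V" "b \<in> V" "c \<in> V" "d \<in> V" and lt: "px a < px b" "px b < px c" "px c < px d"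
  shows "above a b d \<noteq> above a c d \<Longrightarrow> above a b c \<noteq> above b c d"
    and "above a b d = above a c d \<Longrightarrow> above a b d = above a b c \<or> above a b d = above b c d"
proof -
  have lt': "px a < px c" "px b < px d" using lt by auto
  note t = triple_order(1)[OF V(1,2,3) lt(1,2)] triple_order(1)[OF V(1,2,4) lt(1) lt'(2)]
    triple_order(1)[OF V(1,3,4) lt'(1) lt(3)] triple_order(1)[OF V(2,3,4) lt(2,3)]
  show "above a b d \<noteq> above a c d \<Longrightarrow> above a b c \<noteq> above b c d"
    using t by argo
  show "above a b d = above a c d \<Longrightarrow> above a b d = above a b c \<or> above a b d = above b c d"
    using t by argo
qed

end

section \<open>Separated edges\<close>

lemma below_sideD:
  assumes "below_side e f p eps \<sigma>" "0 < t" "t < eps" "px p = frac s"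
    and "(cis (2 * pi * (s + \<sigma> * t)), y) \<in> e" "(cis (2 * pi * (s + \<sigma> * t)), z) \<in> f"
  shows "y < z"
proof -
  have "px (cis (2 * pi * (s + \<sigma> * t)), w) = frac (px p + \<sigma> * t)" for w
    by (simp add: px_cis assms(4))
  moreover have "t \<in> {0<..<eps}" using assms by simp
  ultimately show ?thesis using assms(1,5,6) unfolding below_side_def py_def by fastforce
qed

text \<open>A crossing fixes opposite orders close to \<open>s\<close> on its two sides; as
  \<open>s\<close> is the only meeting point, they persist up to \<open>u\<close> and
  \<open>v\<close>.\<close>

lemma crossing_switches_order:
  fixes F G :: "real \<Rightarrow> real"
  assumes cont: "continuous_on {u..v} F" "continuous_on {u..v} G"
    and mem: "\<And>x. x \<in> {u..v} \<Longrightarrow> (cis (2 * pi * x), F x) \<in> e"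
      "\<And>x. x \<in> {u..v} \<Longrightarrow> (cis (2 * pi * x), G x) \<in> f"
    and uniq: "\<And>x. x \<in> {u..v} \<Longrightarrow> F x = G x \<Longrightarrow> x = s"
    and s: "s \<in> {u..v}" "F u \<noteq> G u" "F v \<noteq> G v" "F s = G s"
    and cr: "crosses_at e ie f jf p" and p: "px p = frac s"
  shows "(F u < G u) \<noteq> (F v < G v)"
proof -
  have us: "u < s" "s < v" using s by (auto simp: less_le)
  obtain eps where eps: "eps > 0"
    "(below_side e f p eps (-1) \<and> below_side f e p eps 1) \<or>
     (below_side f e p eps (-1) \<and> below_side e f p eps 1)"
    using cr unfolding crosses_at_def by blast
  \<comment> \<open>A distance within the scope of the crossing condition that does not leave the
    interval.\<close>
  define t where "t = min (eps / 2) (min (s - u) (v - s))"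
  have t: "0 < t" "t < eps" "t \<le> s - u" "t \<le> v - s" using eps(1) us by (auto simp: t_def)
  have l: "s + -1 * t \<in> {u..v}" and r: "s + 1 * t \<in> {u..v}" using t by auto
  have "(F (s - t) < G (s - t) \<and> G (s + t) < F (s + t)) \<or>
        (G (s - t) < F (s - t) \<and> F (s + t) < G (s + t))"
    using eps(2) below_sideD[OF _ t(1,2) p mem(1)[OF l] mem(2)[OF l]]
      below_sideD[OF _ t(1,2) p mem(2)[OF l] mem(1)[OF l]]
      below_sideD[OF _ t(1,2) p mem(1)[OF r] mem(2)[OF r]]
      below_sideD[OF _ t(1,2) p mem(2)[OF r] mem(1)[OF r]] by auto
  moreover have "F u < G u \<longleftrightarrow> F (s - t) < G (s - t)"
  proof (rule order_constant[OF cont])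
    show "F x \<noteq> G x" if "x \<in> {u..s - t}" for x using uniq[of x] that t us by auto
  qed (use t us in auto)
  moreover have "F (s + t) < G (s + t) \<longleftrightarrow> F v < G v"
  proof (rule order_constant[OF cont])
    show "F x \<noteq> G x" if "x \<in> {s + t..v}" for x using uniq[of x] that t us by auto
  qed (use t us in auto)
  ultimately show ?thesis by argo
qed

context cyl_flag
begin

lemma ht_in_edge:
  assumes "a \<in> V" "b \<in> V" "px a < px b" "t \<in> {px b..1 + px a} \<or> t + 1 \<in> {px b..1 + px a}"
  shows "(cis (2 * pi * t), ht a b t) \<in> E {a, b}"
proof -
  have "(cis (2 * pi * (t + 1)), ht a b (t + 1)) = (cis (2 * pi * t), ht a b t)"
    unfolding ht_periodic by (simp add: cis_2pi_eq_iff)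
  moreover have *: "(cis (2 * pi * s), ht a b s) \<in> E {a, b}" if "s \<in> {px b..1 + px a}" for s
    unfolding ht_graph(2)[OF assms(1-3)] using that by (rule image_eqI[OF refl])
  ultimately show ?thesis using *[of t] *[of "t + 1"] assms(4) by argo
qed

lemma edge_meet_unique:
  assumes "e \<in> edges_of V" "f \<in> edges_of V" "e \<noteq> f" "p \<in> E e" "p \<in> E f" "q \<in> E e" "q \<in> E f"
  shows "p = q"
  using flag assms unfolding flag_def simple_graph_def by blast

lemma edge_meet_crossing:
  assumes "e \<in> edges_of V" "f \<in> edges_of V" "e \<noteq> f" "p \<in> E e" "p \<in> E f"
  shows "p \<in> e \<inter> f \<or> crosses_at (E e) (rint E e) (E f) (rint E f) p"
  using flag assms unfolding flag_def simple_graph_def by blast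

lemma edge_interior_zero: "e \<in> edges_of V \<Longrightarrow> \<exists>p\<in>rint E e. px p = 0"
  using flag unfolding flag_def by blast

end

section \<open>Two edges separated by a vertical line\<close>

locale separated_pair = cyl_flag +
  fixes a b c d
  assumes V: "a \<in> V" "b \<in> V" "c \<in> V" "d \<in> V"
    and lt: "px a < px b" "px b < px c" "px c < px d"
begin

lemma edges: "{a, b} \<in> edges_of V" "{c, d} \<in> edges_of V" "{a, b} \<noteq> {c, d}" "{a, b} \<inter> {c, d} = {}"
  using edge_in[OF V(1,2) lt(1)] edge_in[OF V(3,4) lt(3)] lt by (auto simp: doubleton_eq_iff)

lemma bounds: "0 < px a" "px d < 1" using px_vertex V by auto

text \<open>As both edges avoid only a gap on the circle, they share two ranges of
  x-coordinates: one around 0, and one between the two pairs of endpoints.\<close>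

definition overlap :: "real set" where
  "overlap = {px d..1 + px a} \<union> {px b..px c}"

lemma in_both:
  assumes "x \<in> overlap"
  shows "(cis (2 * pi * x), ht a b x) \<in> E {a, b}" "(cis (2 * pi * x), ht c d x) \<in> E {c, d}"
  using ht_in_edge[OF V(1,2) lt(1), of x] ht_in_edge[OF V(3,4) lt(3), of x] assms lt bounds
  by (auto simp: overlap_def)

lemma cont:
  "continuous_on {px d..1 + px a} (ht a b)" "continuous_on {px d..1 + px a} (ht c d)"
  "continuous_on {px b..px c} (ht a b)" "continuous_on {px b..px c} (ht c d)"
proof -
  note g = ht_graph(1)[OF V(1,2) lt(1)] ht_graph(1)[OF V(3,4) lt(3)]
  show "continuous_on {px d..1 + px a} (ht a b)" "continuous_on {px b..px c} (ht a b)"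
    by (rule continuous_on_subset[OF g(1)]; use lt bounds in force)+
  show "continuous_on {px d..1 + px a} (ht c d)"
    by (rule continuous_on_subset[OF g(2)]) (use lt in auto)
  have "continuous_on {px b..px c} (\<lambda>x. ht c d (x + 1))"
    by (rule continuous_on_compose2[OF g(2), of _ "\<lambda>x. x + 1"])
      (use lt bounds in \<open>auto intro!: continuous_intros\<close>)
  then show "continuous_on {px b..px c} (ht c d)" by (simp only: ht_periodic)
qed

text \<open>At each end of the two ranges one of the edges ends in a vertex, so the order there is
  the sign of a triple: directly at \<open>c\<close> and \<open>d\<close>, through the second part
  of \<open>triple_order\<close> at \<open>a\<close> and \<open>b\<close>.\<close>

lemma end_orders:
  "ht a b (px d) < ht c d (px d) \<longleftrightarrow> above a b d"
  "ht a b (1 + px a) < ht c d (1 + px a) \<longleftrightarrow> above a c d"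
  "ht a b (px b) < ht c d (px b) \<longleftrightarrow> above b c d"
  "ht a b (px c) < ht c d (px c) \<longleftrightarrow> above a b c"
proof -
  note ends = ht_ends[OF V(1,2) lt(1)] ht_ends[OF V(3,4) lt(3)]
  have p: "ht c d (1 + px w) = ht c d (px w)" for w using ht_periodic[of c d "px w"] by (simp add: add.commute)
  have ac: "px a < px c" using lt by simp
  show "ht a b (px d) < ht c d (px d) \<longleftrightarrow> above a b d"
    by (simp add: above_def ends)
  show "ht a b (1 + px a) < ht c d (1 + px a) \<longleftrightarrow> above a c d"
    unfolding triple_order(2)[OF V(1,3,4) ac lt(3)] ends(2) ..
  show "ht a b (px b) < ht c d (px b) \<longleftrightarrow> above b c d"
    unfolding triple_order(2)[OF V(2,3,4) lt(2,3)] ends(1) p ..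
  show "ht a b (px c) < ht c d (px c) \<longleftrightarrow> above a b c"
    unfolding above_def ends(4)[symmetric] p ..
qed

text \<open>The two ranges remain disjoint modulo 1, so different parameters would give two common
  points, contrary to simplicity.\<close>

lemma meet_unique:
  assumes "x \<in> overlap" "y \<in> overlap" "ht a b x = ht c d x" "ht a b y = ht c d y"
  shows "x = y"
proof -
  have "(cis (2 * pi * x), ht a b x) = (cis (2 * pi * y), ht a b y)"
    using in_both[OF assms(1)] in_both[OF assms(2)] unfolding assms(3,4)[symmetric]
    by (rule edge_meet_unique[OF edges(1-3)])
  then have "px (cis (2 * pi * x), ht a b x) = px (cis (2 * pi * y), ht a b y)" by (rule arg_cong)
  then have "frac x = frac y" by (simp only: px_cis)
  then have "x = y \<or> x = y + 1 \<or> y = x + 1"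
  proof (rule frac_eq_cases)
    have "0 < z \<and> z < 2" if "z \<in> overlap" for z using that lt bounds by (auto simp: overlap_def)
    from this[OF assms(1)] this[OF assms(2)] show "\<bar>x - y\<bar> < 2" by linarith
  qed
  then show ?thesis
    using assms(1,2) lt bounds unfolding overlap_def Un_iff atLeastAtMost_iff by argo
qed

text \<open>Otherwise the edges would have to meet in each of the two ranges.\<close>

lemma above_middle: "above a b d \<longleftrightarrow> above a c d"
proof (rule ccontr)
  assume ne: "above a b d \<noteq> above a c d"
  then have ne': "above a b c \<noteq> above b c d" by (rule quadruple_order(1)[OF V lt])
  have "\<exists>x\<in>{px d..1 + px a}. ht a b x = ht c d x"
  proof (rule ccontr)
    assume "\<not> ?thesis"
    then have "ht a b x \<noteq> ht c d x" if "x \<in> {px d..1 + px a}" for x using that by blast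
    from order_constant[OF cont(1,2) subset_refl subset_refl this]
    have "ht a b (px d) < ht c d (px d) \<longleftrightarrow> ht a b (1 + px a) < ht c d (1 + px a)"
      using bounds by simp
    with ne show False unfolding end_orders by (rule notE)
  qed
  moreover have "\<exists>x\<in>{px b..px c}. ht a b x = ht c d x"
  proof (rule ccontr)
    assume "\<not> ?thesis"
    then have "ht a b x \<noteq> ht c d x" if "x \<in> {px b..px c}" for x using that by blast
    from order_constant[OF cont(3,4) subset_refl subset_refl this]
    have "ht a b (px b) < ht c d (px b) \<longleftrightarrow> ht a b (px c) < ht c d (px c)"
      using lt by simp
    then have "above a b c \<longleftrightarrow> above b c d" unfolding end_orders by (rule sym)
    with ne' show False by (rule notE)
  qed
  ultimately obtain x y where xy: "x \<in> {px d..1 + px a}" "y \<in> {px b..px c}"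
    "ht a b x = ht c d x" "ht a b y = ht c d y" by blast
  then have "x \<in> overlap" "y \<in> overlap" by (simp_all add: overlap_def)
  from meet_unique[OF this xy(3,4)] show False using xy(1,2) lt by simp
qed

text \<open>Lifts of a common x-coordinate either coincide, in the range around 0, or differ by one
  turn, in the range between the pairs of endpoints.\<close>

lemma overlap_points:
  assumes "s \<in> {px b..1 + px a}" "t \<in> {px d..1 + px c}" "frac s = frac t"
  shows "s \<in> overlap" "ht c d t = ht c d s"
proof -
  have "s = t \<or> s = t + 1 \<or> t = s + 1"
    by (rule frac_eq_cases[OF assms(3)]) (use assms lt bounds in auto)
  then have "s = t \<or> t = s + 1" using assms lt by auto
  then show "s \<in> overlap" "ht c d t = ht c d s"
    using assms(1,2) lt ht_periodic[of c d s] by (auto simp: overlap_def)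
qed

lemma above_all:
  assumes "above a b c \<longleftrightarrow> above b c d"
  shows "above a b d \<longleftrightarrow> above a b c" "above a c d \<longleftrightarrow> above a b c"
  using quadruple_order(2)[OF V lt above_middle] above_middle assms by auto

text \<open>A common point would be a crossing and would switch the order between the ends of its
  range. The orders at the ends agree, by \<open>above_middle\<close> around 0 and by
  \<open>eq\<close> in the other range.\<close>

lemma disjoint_edges:
  assumes eq: "above a b c \<longleftrightarrow> above b c d"
  shows "E {a, b} \<inter> E {c, d} = {}"
proof (rule ccontr)
  assume "\<not> ?thesis"
  then obtain p where p: "p \<in> E {a, b}" "p \<in> E {c, d}" by blast
  have cr: "crosses_at (E {a, b}) (rint E {a, b}) (E {c, d}) (rint E {c, d}) p"
    using edge_meet_crossing[OF edges(1-3) p] edges(4) by simp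
  obtain s where s: "s \<in> {px b..1 + px a}" "p = (cis (2 * pi * s), ht a b s)"
    using p(1) unfolding ht_graph(2)[OF V(1,2) lt(1)] by blast
  obtain t where t: "t \<in> {px d..1 + px c}" "p = (cis (2 * pi * t), ht c d t)"
    using p(2) unfolding ht_graph(2)[OF V(3,4) lt(3)] by blast
  have ps: "px p = frac s" unfolding s(2) by (rule px_cis)
  have pt: "px p = frac t" unfolding t(2) by (rule px_cis)
  note o = overlap_points[OF s(1) t(1) trans[OF sym[OF ps] pt]]
  have Fs: "ht a b s = ht c d s" using s(2) t(2) o(2) by simp
  have uniq: "x = s" if "x \<in> overlap" "ht a b x = ht c d x" for x
    using meet_unique[OF that(1) o(1) that(2) Fs] .
  have "p \<notin> {a, b}" "p \<notin> {c, d}" using cr unfolding crosses_at_def rint_def by auto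
  \<comment> \<open>The edges do not meet at an end of a range: the meeting point would be
    \<open>p\<close>, which by monotonicity would equal the vertex \<open>w\<close>, but a crossing
    is interior to both edges.\<close>
  have ne: "ht a b x \<noteq> ht c d x" if x: "x \<in> overlap" "frac x = px w" "w \<in> e" "e = {a, b} \<or> e = {c, d}" for x w e
  proof
    assume "ht a b x = ht c d x"
    then have "px p = px w" using uniq[OF x(1)] ps x(2) by simp
    moreover have e: "e \<in> edges_of V" "p \<in> E e" using edges(1,2) p x(4) by auto
    moreover have "w \<in> E e" using e(1) x(3) by (rule vertex_in_edge)
    moreover have "x_monotone (E e)" using flag e(1) unfolding flag_def monotone_graph_def by blast
    ultimately have "p = w" unfolding x_monotone_def by blast
    then show False using x(3,4) \<open>p \<notin> {a, b}\<close> \<open>p \<notin> {c, d}\<close> by blast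
  qed
  have fr: "frac (px d) = px d" "frac (1 + px a) = px a" "frac (px b) = px b" "frac (px c) = px c"
    using bounds lt by (auto simp: frac_unique_iff)
  consider "s \<in> {px d..1 + px a}" | "s \<in> {px b..px c}" using o(1) by (auto simp: overlap_def)
  then show False
  proof cases
    case 1
    have "(ht a b (px d) < ht c d (px d)) \<noteq> (ht a b (1 + px a) < ht c d (1 + px a))"
    proof (rule crossing_switches_order[OF cont(1,2) in_both uniq 1 _ _ Fs cr ps])
      show "ht a b (px d) \<noteq> ht c d (px d)"
        by (rule ne[of _ d "{c, d}"]) (use fr bounds in \<open>auto simp: overlap_def\<close>)
      show "ht a b (1 + px a) \<noteq> ht c d (1 + px a)"
        by (rule ne[of _ a "{a, b}"]) (use fr bounds in \<open>auto simp: overlap_def\<close>)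
    qed (auto simp: overlap_def)
    then show False unfolding end_orders using above_middle by (rule notE)
  next
    case 2
    have "(ht a b (px b) < ht c d (px b)) \<noteq> (ht a b (px c) < ht c d (px c))"
    proof (rule crossing_switches_order[OF cont(3,4) in_both uniq 2 _ _ Fs cr ps])
      show "ht a b (px b) \<noteq> ht c d (px b)"
        by (rule ne[of _ b "{a, b}"]) (use fr lt in \<open>auto simp: overlap_def\<close>)
      show "ht a b (px c) \<noteq> ht c d (px c)"
        by (rule ne[of _ c "{c, d}"]) (use fr lt in \<open>auto simp: overlap_def\<close>)
    qed (auto simp: overlap_def)
    then show False unfolding end_orders using eq[symmetric] by (rule notE)
  qed
qed

lemma order_on_overlap:
  assumes eq: "above a b c \<longleftrightarrow> above b c d" and x: "x \<in> overlap"
  shows "ht a b x < ht c d x \<longleftrightarrow> above a b c"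
proof -
  have ne: "ht a b x \<noteq> ht c d x" if "x \<in> overlap" for x
    using disjoint_edges[OF eq] in_both[OF that] by auto
  consider "x \<in> {px d..1 + px a}" | "x \<in> {px b..px c}" using x by (auto simp: overlap_def)
  then show ?thesis
  proof cases
    case 1
    have "ht a b x < ht c d x \<longleftrightarrow> ht a b (px d) < ht c d (px d)"
      by (rule order_constant[OF cont(1,2) subset_refl subset_refl ne])
        (use 1 in \<open>auto simp: overlap_def\<close>)
    then show ?thesis using end_orders(1) above_all(1)[OF eq] by simp
  next
    case 2
    have "ht a b x < ht c d x \<longleftrightarrow> ht a b (px c) < ht c d (px c)"
      by (rule order_constant[OF cont(3,4) subset_refl subset_refl ne])
        (use 2 in \<open>auto simp: overlap_def\<close>)
    then show ?thesis using end_orders(4) by simp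
  qed
qed

lemma related_edges:
  assumes eq: "above a b c \<longleftrightarrow> above b c d"
  shows "related E {a, b} {c, d}"
proof -
  note dj = disjoint_edges[OF eq]
  have order: "py q < py r \<longleftrightarrow> above a b c" "py q \<noteq> py r"
    if qr: "q \<in> rint E {a, b}" "r \<in> rint E {c, d}" "px q = px r" for q r
  proof -
    obtain s where s: "s \<in> {px b..1 + px a}" "q = (cis (2 * pi * s), ht a b s)"
      using qr(1) unfolding rint_def ht_graph(2)[OF V(1,2) lt(1)] by blast
    obtain t where t: "t \<in> {px d..1 + px c}" "r = (cis (2 * pi * t), ht c d t)"
      using qr(2) unfolding rint_def ht_graph(2)[OF V(3,4) lt(3)] by blast
    have "frac s = frac t" using qr(3) unfolding s(2) t(2) px_cis .
    note o = overlap_points[OF s(1) t(1) this]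
    show "py q < py r \<longleftrightarrow> above a b c"
      using order_on_overlap[OF eq o(1)] s(2) t(2) o(2) by (simp add: py_def)
    show "py q \<noteq> py r"
      using dj in_both[OF o(1)] s(2) t(2) o(2) by (auto simp: py_def)
  qed
  \<comment> \<open>The line at 0 meets the interiors of both edges.\<close>
  obtain q r where "q \<in> rint E {a, b}" "r \<in> rint E {c, d}" "px q = 0" "px r = 0"
    using edge_interior_zero[OF edges(1)] edge_interior_zero[OF edges(2)] by blast
  then have "\<exists>q\<in>rint E {a, b}. \<exists>r\<in>rint E {c, d}. px q = px r" by metis
  moreover have "\<not> crosses_at (E {a, b}) (rint E {a, b}) (E {c, d}) (rint E {c, d}) p" for p
    using dj unfolding crosses_at_def rint_def by blast
  moreover have "(\<forall>q\<in>rint E {a, b}. \<forall>r\<in>rint E {c, d}. px q = px r \<longrightarrow> py q \<le> py r) \<or>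
      (\<forall>q\<in>rint E {a, b}. \<forall>r\<in>rint E {c, d}. px q = px r \<longrightarrow> py r \<le> py q)"
    using order by (cases "above a b c") (auto simp: less_imp_le not_less)
  ultimately show ?thesis unfolding related_def by blast
qed

end

section \<open>Proper sets from chains\<close>

lemma related_commute: "related E e f \<Longrightarrow> related E f e"
proof -
  assume r: "related E e f"
  have "crosses_at (E f) (rint E f) (E e) (rint E e) p \<Longrightarrow> crosses_at (E e) (rint E e) (E f) (rint E f) p" for p
    unfolding crosses_at_def by blast
  then show "related E f e" using r unfolding related_def by metis
qed

lemma finite_strict_enumeration:
  fixes f :: "'a \<Rightarrow> real"
  assumes "finite V" "inj_on f V"
  obtains v where "bij_betw v {..<card V} V" "\<And>i j. i < j \<Longrightarrow> j < card V \<Longrightarrow> f (v i) < f (v j)"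
proof -
  define xs where "xs = sorted_list_of_set (f ` V)"
  define x where "x i = xs ! i" for i
  have xs: "distinct xs" "length xs = card V" "set xs = f ` V" "sorted_wrt (<) xs"
    using assms by (simp_all add: xs_def card_image)
  have x: "bij_betw x {..<card V} (f ` V)"
    using bij_betw_nth[OF xs(1), of "{..<card V}" "f ` V"] xs(2,3) unfolding x_def by simp
  have b: "bij_betw f V (f ` V)" using assms(2) by (rule inj_on_imp_bij_betw)
  show ?thesis
  proof
    show "bij_betw (the_inv_into V f \<circ> x) {..<card V} V"
      using x bij_betw_the_inv_into[OF b] by (rule bij_betw_trans)
    have fx: "f ((the_inv_into V f \<circ> x) i) = x i" if "i < card V" for i
      using f_the_inv_into_f[OF assms(2), of "x i"] bij_betw_apply[OF x, of i] that by simp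
    show "f ((the_inv_into V f \<circ> x) i) < f ((the_inv_into V f \<circ> x) j)" if "i < j" "j < card V" for i j
      using sorted_wrt_nth_less[OF xs(4), of i j] that fx[of i] fx[of j] xs(2) by (simp add: x_def)
  qed
qed

section \<open>Numbering the vertices from left to right\<close>

locale enumerated_flag = cyl_flag +
  fixes v :: "nat \<Rightarrow> cpt" and n :: nat
  assumes v_in: "i < n \<Longrightarrow> v i \<in> V"
    and v_mono: "i < j \<Longrightarrow> j < n \<Longrightarrow> px (v i) < px (v j)"
begin

text \<open>The function T of the overview, with \<open>Suc i\<close> as the representative middle
  vertex; meaningful for \<open>Suc i < k < n\<close>.\<close>

definition row :: "nat \<Rightarrow> nat \<Rightarrow> bool" where
  "row i k \<longleftrightarrow> above (v i) (v (Suc i)) (v k)"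

definition edge :: "nat \<times> nat \<Rightarrow> cpt set" where
  "edge p = {v (fst p), v (snd p)}"

lemma separated: "i < j \<Longrightarrow> j < k \<Longrightarrow> k < l \<Longrightarrow> l < n \<Longrightarrow> separated_pair V E (v i) (v j) (v k) (v l)"
  by unfold_locales (auto intro: v_in v_mono)

lemma above_row:
  assumes "i < j" "j < k" "k < n"
  shows "above (v i) (v j) (v k) \<longleftrightarrow> row i k"
proof (cases "j = Suc i")
  case False
  then have "Suc i < j" using assms by simp
  then show ?thesis
    unfolding row_def using separated_pair.above_middle[OF separated[OF lessI _ assms(2,3)]] by blast
qed (simp add: row_def)

text \<open>The triples ijk, ijl and jkl compute the three entries, and there is at most one sign
  change along the four triples.\<close>

sublocale row_rule row n
proof
  fix i j k l assume ijkl: "i < j" "j < k" "k < l" "l < n"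
  interpret separated_pair V E "v i" "v j" "v k" "v l" by (rule separated[OF ijkl])
  have "i < k" "j < l" "k < n" using ijkl by auto
  note r = above_row[OF ijkl(1,2) this(3)] above_row[OF ijkl(1) this(2) ijkl(4)]
    above_row[OF ijkl(2-4)]
  show "row i l = row i k \<or> row i l = row j l"
    using quadruple_order(2)[OF V lt above_middle] unfolding r .
qed

lemma disj_pairs_edges:
  assumes "disj_pairs row p q" "fst p < snd p" "fst q < snd q" "snd q < n"
  shows "E (edge p) \<inter> E (edge q) = {}" "related E (edge p) (edge q)" "left_of (edge p) (edge q)"
proof -
  obtain a b c d where pq: "p = (a, b)" "q = (c, d)" by (cases p, cases q) blast
  have o: "a < b" "b < c" "c < d" "d < n" and r: "row a c = row b d"
    using assms unfolding pq disj_pairs_def by simp_all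
  interpret separated_pair V E "v a" "v b" "v c" "v d" by (rule separated[OF o])
  have eq: "above (v a) (v b) (v c) \<longleftrightarrow> above (v b) (v c) (v d)"
    using above_row[of a b c] above_row[of b c d] o r by simp
  show "E (edge p) \<inter> E (edge q) = {}" "related E (edge p) (edge q)"
    using disjoint_edges[OF eq] related_edges[OF eq] by (simp_all add: edge_def pq)
  show "left_of (edge p) (edge q)" using lt by (auto simp: edge_def pq left_of_def)
qed

text \<open>Any two edges are separated by a vertical line, so one of the first two alternatives for
  proper sets always applies. Distinct pairs give distinct edges because these are disjoint and
  nonempty.\<close>

lemma pair_chain_proper:
  assumes M: "pair_chain row 0 n M"
  shows "proper_set V E (edge ` M)" "card (edge ` M) = card M"
proof -
  have bd: "fst p < snd p" "snd p < n" if "p \<in> M" for p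
    using pair_chain_bounds[OF M, of "fst p" "snd p"] that by auto
  have sep: "E (edge p) \<inter> E (edge q) = {} \<and> related E (edge p) (edge q) \<and>
      (left_of (edge p) (edge q) \<or> left_of (edge q) (edge p))"
    if "p \<in> M" "q \<in> M" "p \<noteq> q" for p q
  proof -
    have "disj_pairs row p q \<or> disj_pairs row q p" using M that unfolding pair_chain_def by blast
    then show ?thesis
    proof
      assume "disj_pairs row p q"
      from disj_pairs_edges[OF this bd(1)[OF that(1)] bd[OF that(2)]] show ?thesis by blast
    next
      assume "disj_pairs row q p"
      from disj_pairs_edges[OF this bd(1)[OF that(2)] bd[OF that(1)]]
      show ?thesis using related_commute by blast
    qed
  qed
  have "edge p \<in> edges_of V" if "p \<in> M" for p
    unfolding edge_def using bd[OF that] by (intro edge_in v_in v_mono) auto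
  then show "proper_set V E (edge ` M)"
    unfolding proper_set_def using sep by (intro conjI ballI impI; blast)
  have "inj_on edge M"
  proof (rule inj_onI, rule ccontr)
    fix p q assume pq: "p \<in> M" "q \<in> M" "edge p = edge q" "p \<noteq> q"
    have "v (fst p) \<in> E (edge p)"
      using \<open>\<And>p. p \<in> M \<Longrightarrow> edge p \<in> edges_of V\<close>[OF pq(1)] by (rule vertex_in_edge) (simp add: edge_def)
    then show False using sep[OF pq(1,2,4)] unfolding pq(3) by blast
  qed
  then show "card (edge ` M) = card M" by (rule card_image)
qed

end

theorem theorem7:
  fixes V :: "cpt set" and E :: "cpt set \<Rightarrow> cpt set"
  assumes "flag V E" and "card V \<ge> 10"
  shows "\<exists>M. proper_set V E M \<and> card M = nat \<lceil>real (card V) / 25\<rceil> + 1"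
proof -
  interpret cyl_flag V E by unfold_locales (rule assms(1))
  have "finite V" "inj_on px V"
    using assms(1) unfolding flag_def complete_cyl_graph_def monotone_graph_def inj_on_def by blast+
  then obtain v where v: "bij_betw v {..<card V} V"
    "\<And>i j. i < j \<Longrightarrow> j < card V \<Longrightarrow> px (v i) < px (v j)"
    using finite_strict_enumeration by metis
  interpret enumerated_flag V E v "card V"
    by unfold_locales (use v bij_betw_apply[OF v(1)] in auto)
  obtain M where M: "pair_chain row 0 (card V) M" "card V + 15 \<le> 20 * card M"
    using pair_chain_exists assms(2) by auto
  \<comment> \<open>Two pairs turn the bound with 20 into one with 25: adding
    \<open>5 * card M\<close>, which is at least 10, raises the constant 15 to 25.\<close>
  then have "2 \<le> card M" using assms(2) by linarith
  then have "card V + 25 \<le> 25 * card M" using M(2) by linarith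
  then have "real (card V) / 25 \<le> real (card M) - 1" by simp
  then have "nat \<lceil>real (card V) / 25\<rceil> + 1 \<le> card M" by linarith
  \<comment> \<open>The chain may be too large; any subset of a chain is again a chain.\<close>
  then obtain N where N: "N \<subseteq> M" "card N = nat \<lceil>real (card V) / 25\<rceil> + 1"
    by (rule obtain_subset_with_card_n)
  have "pair_chain row 0 (card V) N" using M(1) N(1) by (rule pair_chain_subset)
  from pair_chain_proper[OF this] N(2) show ?thesis by (intro exI[of _ "edge ` N"]) simp
qed

end
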